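(* Let $n,k,s,p$ be positive integers with $n\geq (s+1)k$, and let $\vec{p}=(p_0,p_1,\ldots,p_s)=(p,1,\ldots,1)$ (so $p_0=p$ and $p_1=\cdots=p_s=1$). Then $$f_{\vec{p}}(n,k,s)\leq \max\left\{s\binom{n}{k},\ (p+s)s\binom{n-1}{k-1}\right\}.$$
   Context: $[n]=\{1,\ldots,n\}$ and $\binom{[n]}{k}$ is the collection of all $k$-element subsets of $[n]$. For families $\mathcal{A}_1,\ldots,\mathcal{A}_m\subseteq 2^{[n]}$ the rainbow matching number $\nu(\mathcal{A}_1,\ldots,\mathcal{A}_m)$ is the maximum integer $r$ such that there are indices $1\leq i_1<\cdots<i_r\leq m$ and pairwise disjoint sets $A_{i_1}\in\mathcal{A}_{i_1},\ldots,A_{i_r}\in\mathcal{A}_{i_r}$. A sequence of $s+1$ families $\mathcal{B}_0,\mathcal{B}_1,\ldots,\mathcal{B}_s\subseteq 2^{[n]}$ is called overlapping if $\nu(\mathcal{B}_0,\ldots,\mathcal{B}_s)\leq s$, i.e. one cannot choose pairwise disjoint sets $B_i\in\mathcal{B}_i$, $i=0,\ldots,s$. For real constants $p_0\geq p_1\geq\cdots\geq p_s>0$, $\vec{p}=(p_0,\ldots,p_s)$ and $n\geq (s+1)k$, define $$f_{\vec{p}}(n,k,s)=\max\left\{\sum_{i=0}^s p_i|\mathcal{B}_i| : \mathcal{B}_0\subseteq\mathcal{B}_1\subseteq\cdots\subseteq\mathcal{B}_s\subseteq\binom{[n]}{k}\text{ are overlapping}\right\}$$ (families may be empty and may coincide).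 *)

theory Defs
  imports Complex_Main "HOL-Library.Ramsey" "HOL-Library.Disjoint_Sets"
begin

text \<open>
  The families are indexed by a finite set \<open>I\<close> of natural numbers; choosing indices
  \<open>i\<^sub>1 < \<dots> < i\<^sub>r\<close> in \<open>I\<close> amounts to choosing \<open>J \<subseteq> I\<close> with \<open>card J = r\<close>.
\<close>

definition rainbow_matching ::
    "nat set \<Rightarrow> (nat \<Rightarrow> 'a set set) \<Rightarrow> nat set \<Rightarrow> (nat \<Rightarrow> 'a set) \<Rightarrow> bool" where
  "rainbow_matching I \<A> J A \<longleftrightarrow>
     J \<subseteq> I \<and> (\<forall>i\<in>J. A i \<in> \<A> i) \<and> disjoint_family_on A J"

definition rainbow_matching_number :: "nat set \<Rightarrow> (nat \<Rightarrow> 'a set set) \<Rightarrow> nat" where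
  "rainbow_matching_number I \<A> = Max {card J | J. \<exists>A. rainbow_matching I \<A> J A}"

definition overlapping :: "nat \<Rightarrow> (nat \<Rightarrow> 'a set set) \<Rightarrow> bool" where
  "overlapping s \<B> \<longleftrightarrow> rainbow_matching_number {0..s} \<B> \<le> s"

text \<open>
  Only the values \<open>\<B> 0, \<dots>, \<B> s\<close> matter below. The collection of all \<open>k\<close>-element
  subsets of \<open>{1..n}\<close> is \<open>nsets {1..n} k\<close>, from the Ramsey library.
\<close>

definition admissible :: "nat \<Rightarrow> nat \<Rightarrow> nat \<Rightarrow> (nat \<Rightarrow> nat set set) \<Rightarrow> bool" where
  "admissible n k s \<B> \<longleftrightarrow>
     mono_on {0..s} \<B> \<and> (\<forall>i\<in>{0..s}. \<B> i \<subseteq> nsets {1..n} k) \<and> overlapping s \<B>"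

definition f_max :: "(nat \<Rightarrow> real) \<Rightarrow> nat \<Rightarrow> nat \<Rightarrow> nat \<Rightarrow> real" where
  "f_max p n k s =
     Max {\<Sum>i = 0..s. p i * real (card (\<B> i)) | \<B>. admissible n k s \<B>}"

text \<open>
  The sets under \<open>Max\<close> are finite and nonempty, so both maxima are genuine.
\<close>

lemma rainbow_matching_number_set:
  assumes "finite I"
  shows "finite {card J | J. \<exists>A. rainbow_matching I \<A> J A}"
    and "{card J | J. \<exists>A. rainbow_matching I \<A> J A} \<noteq> {}"
proof -
  have "{card J | J. \<exists>A. rainbow_matching I \<A> J A} \<subseteq> card ` Pow I"
    by (auto simp: rainbow_matching_def)
  then show "finite {card J | J. \<exists>A. rainbow_matching I \<A> J A}"
    using assms by (meson finite_Pow_iff finite_imageI finite_subset)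
  have "rainbow_matching I \<A> {} (\<lambda>_. {})"
    by (simp add: rainbow_matching_def disjoint_family_on_def)
  then show "{card J | J. \<exists>A. rainbow_matching I \<A> J A} \<noteq> {}"
    by blast
qed

lemma overlapping_iff:
  "overlapping s \<B> \<longleftrightarrow>
     \<not> (\<exists>B. (\<forall>i\<in>{0..s}. B i \<in> \<B> i) \<and> disjoint_family_on B {0..s})"
proof -
  have "overlapping s \<B> \<longleftrightarrow> (\<forall>J B. rainbow_matching {0..s} \<B> J B \<longrightarrow> card J \<le> s)"
    unfolding overlapping_def rainbow_matching_number_def
    by (subst Max_le_iff) (use rainbow_matching_number_set[of "{0..s}" \<B>] in auto)
  also have "\<dots> \<longleftrightarrow> (\<forall>B. \<not> rainbow_matching {0..s} \<B> {0..s} B)"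
  proof
    assume "\<forall>J B. rainbow_matching {0..s} \<B> J B \<longrightarrow> card J \<le> s"
    then show "\<forall>B. \<not> rainbow_matching {0..s} \<B> {0..s} B"
      by fastforce
  next
    assume *: "\<forall>B. \<not> rainbow_matching {0..s} \<B> {0..s} B"
    show "\<forall>J B. rainbow_matching {0..s} \<B> J B \<longrightarrow> card J \<le> s"
    proof (intro allI impI)
      fix J B assume J: "rainbow_matching {0..s} \<B> J B"
      then have "J \<subset> {0..s}"
        using * by (auto simp: rainbow_matching_def)
      then have "card J < card {0..s}"
        by (intro psubset_card_mono) auto
      then show "card J \<le> s" by simp
    qed
  qed
  finally show ?thesis by (auto simp: rainbow_matching_def)
qed

lemma f_max_set:
  shows "finite {\<Sum>i = 0..s. p i * real (card (\<B> i)) | \<B>. admissible n k s \<B>}"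
    and "{\<Sum>i = 0..s. p i * real (card (\<B> i)) | \<B>. admissible n k s \<B>} \<noteq> {}"
proof -
  let ?F = "PiE {0..s} (\<lambda>_. Pow (nsets {1..n} k))"
  have "{\<Sum>i = 0..s. p i * real (card (\<B> i)) | \<B>. admissible n k s \<B>}
      \<subseteq> (\<lambda>\<B>. \<Sum>i = 0..s. p i * real (card (\<B> i))) ` ?F"
  proof clarify
    fix \<B> assume "admissible n k s \<B>"
    then have "restrict \<B> {0..s} \<in> ?F"
      by (auto simp: admissible_def)
    moreover have "(\<Sum>i = 0..s. p i * real (card (\<B> i)))
        = (\<Sum>i = 0..s. p i * real (card (restrict \<B> {0..s} i)))"
      by (intro sum.cong) auto
    ultimately show "(\<Sum>i = 0..s. p i * real (card (\<B> i)))
        \<in> (\<lambda>\<B>. \<Sum>i = 0..s. p i * real (card (\<B> i))) ` ?F"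
      by blast
  qed
  moreover have "finite ?F"
    by (intro finite_PiE) (auto simp: finite_imp_finite_nsets)
  ultimately show "finite {\<Sum>i = 0..s. p i * real (card (\<B> i)) | \<B>. admissible n k s \<B>}"
    by (meson finite_imageI finite_subset)
  have "admissible n k s (\<lambda>_. {})"
    by (auto simp: admissible_def overlapping_iff mono_on_def)
  then show "{\<Sum>i = 0..s. p i * real (card (\<B> i)) | \<B>. admissible n k s \<B>} \<noteq> {}"
    by blast
qed

end

theory Submission
  imports Defs "HOL-Combinatorics.Permutations"
begin

text \<open>
  Katona's circle method. Order \<open>{1..n}\<close> cyclically at random and let \<open>A i\<close> be the set of
  starting points of the arcs of length \<open>k\<close> that belong to \<open>\<B> i\<close>. Any \<open>(s + 1) k\<close> points of the
  circle, listed in cyclic order, split by their index modulo \<open>k\<close> into \<open>k\<close> classes, each consisting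
  of starting points of \<open>s + 1\<close> pairwise disjoint arcs. Since the families are nested and
  overlapping, every class contains at most \<open>i\<close> points of \<open>A i\<close> for some \<open>i \<le> s\<close>. A suitable choice
  of the \<open>(s + 1) k\<close> points then gives \<open>|A 0| \<le> s k\<close> and
  \<open>(n / k - s) |A 0| + |A 1| + \<dots> + |A s| \<le> s n\<close>. These two inequalities imply
  the bound on the circle for every weight \<open>p\<close>, and averaging over the cyclic orders finishes the proof.
\<close>

section \<open>Distinct representatives and sums with a deficient term\<close>

text \<open>Greedy choice: the representatives already chosen for \<open>0\<close>, ...,
  \<open>s\<close> occupy at most \<open>s + 1\<close> points, so the more than \<open>s + 1\<close>
  points of \<open>A (Suc s)\<close> leave a fresh one.\<close>

lemma rainbow_selection:
  fixes A :: "nat \<Rightarrow> 'a set"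
  assumes "\<And>i. i \<le> s \<Longrightarrow> i < card (A i)"
  shows "\<exists>f. inj_on f {0..s} \<and> (\<forall>i\<in>{0..s}. f i \<in> A i)"
  using assms
proof (induction s)
  case 0
  then have "A 0 \<noteq> {}" by force
  then show ?case by auto
next
  case (Suc s)
  then obtain f where f: "inj_on f {0..s}" "\<forall>i\<in>{0..s}. f i \<in> A i"
    by (metis le_SucI)
  have "card (f ` {0..s}) < card (A (Suc s))"
    using card_image_le[of "{0..s}" f] Suc.prems[of "Suc s"] by simp
  then obtain y where y: "y \<in> A (Suc s)" "y \<notin> f ` {0..s}"
    by (meson card_mono finite_atLeastAtMost finite_imageI leD subsetI)
  have "inj_on (f(Suc s := y)) {0..Suc s}"
    using f(1) y(2) by (auto simp: inj_on_def le_Suc_eq)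
  moreover have "\<forall>i\<in>{0..Suc s}. (f(Suc s := y)) i \<in> A i"
    using f(2) y(1) by (auto simp: le_Suc_eq)
  ultimately show ?case by blast
qed

text \<open>By monotonicity the first \<open>i + 1\<close> terms are at most \<open>i\<close> each,
  and the other \<open>s - i\<close> terms are at most \<open>s + 1\<close>. Enlarging the factor
  \<open>i + 1\<close> to \<open>s + 1\<close> makes the bound independent of
  \<open>i\<close>.\<close>

lemma deficient_sum_le:
  fixes x :: "nat \<Rightarrow> nat"
  assumes mono: "\<And>l m. l \<le> m \<Longrightarrow> m \<le> s \<Longrightarrow> x l \<le> x m"
    and top: "x s \<le> s + 1" and i: "i \<le> s" "x i \<le> i"
  shows "(\<Sum>l = 0..s. x l) \<le> s * (s + 1)"
proof -
  have "(\<Sum>l = 0..s. x l) = (\<Sum>l = 0..i. x l) + (\<Sum>l = i + 1..s. x l)"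
    using i(1) sum.ub_add_nat[of 0 i x "s - i"] by simp
  also have "\<dots> \<le> (\<Sum>l = 0..i. i) + (\<Sum>l = i + 1..s. s + 1)"
    using i order_trans[OF mono[OF _ order_refl] top]
    by (intro add_mono sum_mono) (auto intro: order_trans[OF mono])
  also have "\<dots> = (i + 1) * i + (s - i) * (s + 1)"
    by simp
  also have "\<dots> \<le> (s + 1) * i + (s - i) * (s + 1)"
    using i(1) by (intro add_mono mult_right_mono) auto
  also have "\<dots> = (i + (s - i)) * (s + 1)"
    by (simp only: algebra_simps)
  also have "\<dots> = s * (s + 1)"
    using i(1) by simp
  finally show ?thesis .
qed

section \<open>Inequalities for nested deficient sets\<close>

text \<open>The assumption \<open>deficient\<close> isolates what the counting uses about arcs. On
  the circle, \<open>V\<close> is the set of starting points and the \<open>C r\<close> are the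
  index classes modulo \<open>k\<close>.\<close>

locale deficient_families =
  fixes V :: "'a set" and A :: "nat \<Rightarrow> 'a set" and n k s :: nat
  assumes finite_V: "finite V" and card_V: "card V = n" and size: "(s + 1) * k \<le> n"
    and k_pos: "0 < k"
    and A_mono: "\<And>i j. i \<le> j \<Longrightarrow> j \<le> s \<Longrightarrow> A i \<subseteq> A j"
    and A_sub: "\<And>i. i \<le> s \<Longrightarrow> A i \<subseteq> V"
    and deficient: "\<And>P. P \<subseteq> V \<Longrightarrow> card P = (s + 1) * k \<Longrightarrow>
      \<exists>C. P = (\<Union>r<k. C r) \<and> disjoint_family_on C {..<k} \<and>
          (\<forall>r<k. card (C r) = s + 1 \<and> (\<exists>i\<le>s. card (A i \<inter> C r) \<le> i))"
begin

lemma classes: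
  assumes "P \<subseteq> V" "card P = (s + 1) * k"
  obtains C where "P = (\<Union>r<k. C r)" "\<And>r. r < k \<Longrightarrow> finite (C r)"
    "\<And>r. r < k \<Longrightarrow> card (C r) = s + 1"
    "\<And>r. r < k \<Longrightarrow> \<exists>i\<le>s. card (A i \<inter> C r) \<le> i"
    "\<And>i. card (A i \<inter> P) = (\<Sum>r<k. card (A i \<inter> C r))"
proof -
  obtain C where C: "P = (\<Union>r<k. C r)" "disjoint_family_on C {..<k}"
    "\<And>r. r < k \<Longrightarrow> card (C r) = s + 1" "\<And>r. r < k \<Longrightarrow> \<exists>i\<le>s. card (A i \<inter> C r) \<le> i"
    using deficient[OF assms] by blast
  \<comment> \<open>An infinite set has \<open>card\<close> 0, which \<open>s + 1\<close>
    excludes.\<close>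
  have fin: "finite (C r)" if "r < k" for r
    using C(3)[OF that] card.infinite by fastforce
  have "card (A i \<inter> P) = (\<Sum>r<k. card (A i \<inter> C r))" for i
  proof -
    have "A i \<inter> P = (\<Union>r\<in>{..<k}. A i \<inter> C r)"
      using C(1) by blast
    also have "card \<dots> = (\<Sum>r<k. card (A i \<inter> C r))"
      using C(2) fin by (intro card_UN_disjoint) (auto simp: disjoint_family_on_def)
    finally show ?thesis .
  qed
  with C fin that show thesis by blast
qed

text \<open>Inside one class the counts are nondecreasing in \<open>i\<close> and one of them is
  deficient, so \<open>deficient_sum_le\<close> bounds the contribution of each of the
  \<open>k\<close> classes by \<open>s * (s + 1)\<close>.\<close>

lemma sum_card_Int_le:
  assumes "P \<subseteq> V" "card P = (s + 1) * k"
  shows "(\<Sum>i = 0..s. card (A i \<inter> P)) \<le> s * (s + 1) * k"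
proof -
  obtain C where C: "\<And>r. r < k \<Longrightarrow> finite (C r)" "\<And>r. r < k \<Longrightarrow> card (C r) = s + 1"
    "\<And>r. r < k \<Longrightarrow> \<exists>i\<le>s. card (A i \<inter> C r) \<le> i"
    "\<And>i. card (A i \<inter> P) = (\<Sum>r<k. card (A i \<inter> C r))"
    using classes[OF assms] by metis
  have "(\<Sum>i = 0..s. card (A i \<inter> C r)) \<le> s * (s + 1)" if r: "r < k" for r
  proof -
    obtain i where i: "i \<le> s" "card (A i \<inter> C r) \<le> i"
      using C(3)[OF r] by blast
    have "card (A l \<inter> C r) \<le> card (A m \<inter> C r)" if "l \<le> m" "m \<le> s" for l m
      using A_mono[OF that] C(1)[OF r] by (intro card_mono) auto
    moreover have "card (A s \<inter> C r) \<le> s + 1"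
      using C(1,2)[OF r] by (metis Int_lower2 card_mono)
    ultimately show ?thesis
      using i by (rule deficient_sum_le)
  qed
  then have "(\<Sum>r<k. \<Sum>i = 0..s. card (A i \<inter> C r)) \<le> (\<Sum>r<k. s * (s + 1))"
    by (intro sum_mono) auto
  then show ?thesis
    by (subst (asm) sum.swap) (simp add: C(4) algebra_simps)
qed

text \<open>The deficient index of a class lies below \<open>j\<close>, because from
  \<open>j\<close> on the sets contain all \<open>s + 1\<close> points of the class. Hence
  \<open>A 0\<close>, being the smallest set, has at most \<open>j - 1\<close> points in each of the
  \<open>k\<close> classes.\<close>

lemma small_bottom:
  assumes P: "P \<subseteq> V" "card P = (s + 1) * k"
    and full: "\<And>i. j \<le> i \<Longrightarrow> i \<le> s \<Longrightarrow> P \<subseteq> A i"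
  shows "card (A 0 \<inter> P) + k \<le> j * k"
proof -
  obtain C where C: "P = (\<Union>r<k. C r)" "\<And>r. r < k \<Longrightarrow> finite (C r)"
    "\<And>r. r < k \<Longrightarrow> card (C r) = s + 1"
    "\<And>r. r < k \<Longrightarrow> \<exists>i\<le>s. card (A i \<inter> C r) \<le> i"
    "\<And>i. card (A i \<inter> P) = (\<Sum>r<k. card (A i \<inter> C r))"
    using classes[OF P] by metis
  have "card (A 0 \<inter> C r) + 1 \<le> j" if r: "r < k" for r
  proof -
    obtain i where i: "i \<le> s" "card (A i \<inter> C r) \<le> i"
      using C(4)[OF r] by blast
    have "i < j"
    proof (rule ccontr)
      assume "\<not> i < j"
      then have "A i \<inter> C r = C r"
        using full[of i] i(1) C(1) r by auto
      then show False
        using i C(3)[OF r] by simp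
    qed
    moreover have "card (A 0 \<inter> C r) \<le> card (A i \<inter> C r)"
      using A_mono[of 0 i] i(1) C(2)[OF r] by (intro card_mono) auto
    ultimately show ?thesis using i(2) by linarith
  qed
  then have "(\<Sum>r<k. card (A 0 \<inter> C r) + 1) \<le> (\<Sum>r<k. j)"
    by (intro sum_mono) auto
  then show ?thesis
    unfolding sum.distrib C(5) by (simp add: algebra_simps)
qed

text \<open>If \<open>A 0\<close> were larger, some \<open>P\<close> of \<open>(s + 1) * k\<close>
  points would meet it in more than \<open>s * k\<close> points, whereas deficiency leaves at most
  \<open>s\<close> points of \<open>A 0\<close> in each of the \<open>k\<close> classes.\<close>

lemma card_bottom_le: "card (A 0) \<le> s * k"
proof (rule ccontr)
  assume big: "\<not> card (A 0) \<le> s * k"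
  have "\<exists>P. P \<subseteq> V \<and> card P = (s + 1) * k \<and> s * k < card (A 0 \<inter> P)"
  proof (cases "card (A 0) \<le> (s + 1) * k")
    case True
    then obtain P where "A 0 \<subseteq> P" "P \<subseteq> V" "card P = (s + 1) * k"
      using exists_subset_between[of "A 0" "(s + 1) * k" V] A_sub[of 0] size card_V finite_V
      by auto
    then show ?thesis using big by (metis Int_absorb2 not_le)
  next
    case False
    then obtain P where "P \<subseteq> A 0" "card P = (s + 1) * k"
      using obtain_subset_with_card_n[of "(s + 1) * k" "A 0"] by auto
    then show ?thesis
      using A_sub[of 0] k_pos by (intro exI[of _ P]) (auto simp: Int_absorb1)
  qed
  then obtain P where P: "P \<subseteq> V" "card P = (s + 1) * k" "s * k < card (A 0 \<inter> P)"
    by blast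
  \<comment> \<open>For \<open>j = s + 1\<close> no index lies between \<open>j\<close> and
    \<open>s\<close>, so the condition \<open>full\<close> holds trivially.\<close>
  show False
    using small_bottom[OF P(1,2), of "s + 1"] P(3) by simp
qed

text \<open>
  With \<open>j = \<lceil>|A 0| / k\<rceil>\<close>, the set \<open>A j\<close> has at most \<open>(s + 1) k\<close> points. Choosing \<open>P \<supseteq> A j\<close>,
  every point outside \<open>P\<close> lies only in sets \<open>A i\<close> with \<open>i > j\<close>, hence in at most
  \<open>s - |A 0| / k\<close> of them.
\<close>

lemma weighted_card_le:
  "n * card (A 0) + k * (\<Sum>i = 1..s. card (A i)) \<le> s * k * (n + card (A 0))"
proof -
  define N where "N = (s + 1) * k"
  define a where "a = card (A 0)"
  define j where "j = (a + k - 1) div k"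
  have a_le: "a \<le> s * k"
    using card_bottom_le by (simp add: a_def)
  have "j * k \<le> a + k - 1"
    by (simp add: j_def)
  then have j1: "j * k < a + k"
    using k_pos by linarith
  have j2: "a \<le> j * k"
  proof -
    have "a + k - 1 < j * k + k"
      using k_pos dividend_less_div_times[of k "a + k - 1"] by (simp add: j_def)
    then show ?thesis by linarith
  qed
  have "j * k < (s + 1) * k"
    using j1 a_le by simp
  then have js: "j \<le> s"
    by (metis Suc_eq_plus1 less_Suc_eq_le mult_less_cancel2)
  have fin: "finite (A i)" if "i \<le> s" for i
    using A_sub[OF that] finite_V finite_subset by blast
  \<comment> \<open>A larger \<open>A j\<close> would leave room for a set \<open>P\<close> of
    \<open>N\<close> points between \<open>A 0\<close> and \<open>A j\<close>. All later sets
    contain this \<open>P\<close>, so \<open>small_bottom\<close> yields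
    \<open>a + k \<le> j * k\<close>, against \<open>j1\<close>.\<close>
  have cj: "card (A j) \<le> N"
  proof (rule ccontr)
    assume "\<not> card (A j) \<le> N"
    moreover have "card (A 0) \<le> N"
      using a_le by (simp add: a_def N_def)
    ultimately obtain P where P: "A 0 \<subseteq> P" "P \<subseteq> A j" "card P = N"
      using exists_subset_between[of "A 0" N "A j"] A_mono[of 0 j] js fin by force
    have "card (A 0 \<inter> P) + k \<le> j * k"
    proof (rule small_bottom)
      show "P \<subseteq> V" using P(2) A_sub[OF js] by blast
      show "card P = (s + 1) * k" using P(3) by (simp add: N_def)
      show "P \<subseteq> A i" if "j \<le> i" "i \<le> s" for i
        using P(2) A_mono[OF that] by blast
    qed
    then show False
      using P(1) j1 by (simp add: Int_absorb2 a_def)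
  qed
  obtain P where P: "A j \<subseteq> P" "P \<subseteq> V" "card P = N"
    using exists_subset_between[of "A j" N V] cj A_sub[OF js] size card_V finite_V
    by (auto simp: N_def)
  have inside: "card (A i \<inter> P) = card (A i)" if "i \<le> j" for i
    using P(1) A_mono[OF that js] by (metis Int_absorb2 order_trans)
  have outside: "card (A i) \<le> card (A i \<inter> P) + (n - N)" if "i \<le> s" for i
  proof -
    have "card (A i) = card (A i \<inter> P) + card (A i - P)"
      using card_Int_Diff[OF fin[OF that]] .
    moreover have "card (A i - P) \<le> card (V - P)"
      using A_sub[OF that] finite_V by (intro card_mono) auto
    moreover have "card (V - P) = n - N"
      using P(2,3) card_V finite_V finite_subset by (metis card_Diff_subset)
    ultimately show ?thesis by linarith
  qed
  have "(\<Sum>i = 0..s. card (A i))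
      = (\<Sum>i = 0..j. card (A i)) + (\<Sum>i = j + 1..s. card (A i))"
    using js sum.ub_add_nat[of 0 j _ "s - j"] by simp
  also have "\<dots> \<le> (\<Sum>i = 0..j. card (A i \<inter> P)) + (\<Sum>i = j + 1..s. card (A i \<inter> P) + (n - N))"
    by (intro add_mono sum_mono) (auto simp: inside outside)
  also have "\<dots> = (\<Sum>i = 0..s. card (A i \<inter> P)) + (s - j) * (n - N)"
    using js sum.ub_add_nat[of 0 j "\<lambda>i. card (A i \<inter> P)" "s - j"] by (simp add: sum.distrib)
  also have "(\<Sum>i = 0..s. card (A i \<inter> P)) \<le> s * N"
    using sum_card_Int_le[OF P(2)] P(3) by (simp add: N_def algebra_simps)
  finally have "(\<Sum>i = 0..s. card (A i)) \<le> s * N + (s - j) * (n - N)"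
    by simp
  moreover have "(\<Sum>i = 0..s. card (A i)) = a + (\<Sum>i = 1..s. card (A i))"
    by (simp add: a_def sum.atLeast_Suc_atMost)
  \<comment> \<open>Multiplying by \<open>k\<close> clears the fraction \<open>a / k\<close>: the
    factor \<open>s - j\<close> turns into \<open>s * k - j * k\<close>, which is at most
    \<open>s * k - a\<close> by \<open>j2\<close>.\<close>
  ultimately have "k * (a + (\<Sum>i = 1..s. card (A i))) \<le> k * (s * N + (s - j) * (n - N))"
    by (simp only: mult_le_mono2)
  also have "\<dots> = k * s * N + (s * k - j * k) * (n - N)"
    by (simp add: algebra_simps diff_mult_distrib2)
  also have "\<dots> \<le> k * s * N + (s * k - a) * (n - N)"
    using j2 by (intro add_mono mult_right_mono) auto
  finally have main: "k * (a + (\<Sum>i = 1..s. card (A i))) \<le> k * s * N + (s * k - a) * (n - N)" .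
  \<comment> \<open>\<open>d\<close> and \<open>e\<close> replace the truncated differences
    \<open>n - N\<close> and \<open>s * k - a\<close>. The summand \<open>k * a\<close> added in the
    chain below cancels at its end, since \<open>N * a = s * k * a + k * a\<close>.\<close>
  obtain d where d: "n = N + d"
    using size by (metis N_def le_iff_add)
  obtain e where e: "s * k = a + e"
    using a_le by (metis le_iff_add)
  have "n * a + k * (\<Sum>i = 1..s. card (A i)) + k * a
      = N * a + d * a + k * (a + (\<Sum>i = 1..s. card (A i)))"
    by (simp add: d algebra_simps)
  also have "\<dots> \<le> N * a + d * a + (k * s * N + e * d)"
    using main by (simp add: d e)
  also have "\<dots> = N * a + (a + e) * d + s * k * N"
    by (simp add: algebra_simps)
  also have "\<dots> = s * k * (n + a) + k * a"
    by (simp add: e[symmetric] d N_def algebra_simps)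
  finally show ?thesis by (simp add: a_def)
qed

text \<open>In \<open>weighted_card_le\<close> the net coefficient of \<open>card (A 0)\<close> is
  \<open>n - s * k\<close>. If \<open>p * k\<close> does not exceed it, that inequality suffices;
  otherwise the excess \<open>(p + s) * k - n\<close> is paid for by \<open>card_bottom_le\<close>.
  Adding \<open>s * k * card (A 0)\<close> to both sides avoids subtraction.\<close>

lemma two_term_bound:
  "k * (p * card (A 0) + (\<Sum>i = 1..s. card (A i))) \<le> max (s * k * n) ((p + s) * s * k * k)"
proof (cases "(p + s) * k \<le> n")
  case True
  let ?S = "\<Sum>i = 1..s. card (A i)"
  have "k * (p * card (A 0) + ?S) + s * k * card (A 0) = (p + s) * k * card (A 0) + k * ?S"
    by (simp add: algebra_simps)
  also have "\<dots> \<le> n * card (A 0) + k * ?S"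
    using True by (intro add_mono mult_right_mono) auto
  also have "\<dots> \<le> s * k * n + s * k * card (A 0)"
    using weighted_card_le by (simp add: algebra_simps)
  finally show ?thesis by linarith
next
  case False
  let ?S = "\<Sum>i = 1..s. card (A i)"
  obtain d where d: "(p + s) * k = n + d"
    using False by (metis le_iff_add nat_le_linear)
  have "k * (p * card (A 0) + ?S) + s * k * card (A 0) = (p + s) * k * card (A 0) + k * ?S"
    by (simp add: algebra_simps)
  also have "\<dots> = d * card (A 0) + (n * card (A 0) + k * ?S)"
    unfolding d by (simp add: algebra_simps)
  also have "\<dots> \<le> d * (s * k) + s * k * (n + card (A 0))"
    using weighted_card_le card_bottom_le by (intro add_mono mult_left_mono) auto
  also have "\<dots> = (n + d) * (s * k) + s * k * card (A 0)"
    by (simp add: algebra_simps)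
  also have "\<dots> = (p + s) * s * k * k + s * k * card (A 0)"
    unfolding d[symmetric] by (simp add: algebra_simps)
  finally show ?thesis by linarith
qed

end

section \<open>Arcs on the circle\<close>

text \<open>\<open>Suc\<close> moves the residues modulo \<open>n\<close> into the ground set
  \<open>{1..n}\<close>, while starting points will range over \<open>{..<n}\<close>.\<close>

definition arc :: "nat \<Rightarrow> nat \<Rightarrow> nat \<Rightarrow> nat set" where
  "arc n k x = (\<lambda>j. Suc ((x + j) mod n)) ` {..<k}"

lemma arc_in_nsets:
  assumes "0 < k" "k \<le> n"
  shows "arc n k x \<in> nsets {1..n} k"
proof -
  have "inj_on (\<lambda>j. Suc ((x + j) mod n)) {..<k}"
  proof (rule linorder_inj_onI)
    fix i j assume ij: "i < j" "i \<in> {..<k}" "j \<in> {..<k}"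
    show "Suc ((x + i) mod n) \<noteq> Suc ((x + j) mod n)"
    proof
      assume "Suc ((x + i) mod n) = Suc ((x + j) mod n)"
      then have "n dvd (x + j) - (x + i)"
        using ij by (subst mod_eq_dvd_iff_nat[symmetric]) auto
      then show False
        using ij assms dvd_imp_le[of n "j - i"] by auto
    qed
  qed auto
  then show ?thesis
    using assms by (auto simp: arc_def nsets_def card_image Suc_le_eq)
qed

text \<open>The two hypotheses are the gaps from \<open>x\<close> to \<open>y\<close> and from
  \<open>y\<close> round to \<open>x + n\<close>. A common point would make \<open>n\<close> divide
  a difference lying strictly between 0 and \<open>n\<close>.\<close>

lemma arc_disjoint:
  assumes "x + k \<le> y" "y + k \<le> x + n"
  shows "arc n k x \<inter> arc n k y = {}"
proof -
  have "(x + i) mod n \<noteq> (y + j) mod n" if "i < k" "j < k" for i j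
  proof
    assume "(x + i) mod n = (y + j) mod n"
    then have "n dvd (y + j) - (x + i)"
      using assms that by (subst mod_eq_dvd_iff_nat[symmetric]) auto
    then show False
      using assms that nat_dvd_not_less[of "(y + j) - (x + i)" n] by auto
  qed
  then show ?thesis by (auto simp: arc_def)
qed

lemma strict_enumeration_gap:
  fixes e :: "nat \<Rightarrow> nat"
  assumes "\<And>a b. a < b \<Longrightarrow> b < N \<Longrightarrow> e a < e b" "a + d < N"
  shows "e a + d \<le> e (a + d)"
  using assms(2)
proof (induction d)
  case (Suc d)
  then have "e (a + d) < e (a + Suc d)"
    by (intro assms(1)) auto
  then show ?case using Suc by simp
qed simp

text \<open>Class \<open>r\<close> takes every \<open>k\<close>-th point of the increasing
  enumeration, from index \<open>r\<close> on. With \<open>(s + 1) * k\<close> points in all, two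
  members of a class are at least \<open>k\<close> indices apart both ways round the circle, and a
  strictly increasing enumeration of naturals spreads values at least as far as indices.\<close>

lemma arc_classes:
  assumes P: "P \<subseteq> {..<n}" "card P = (s + 1) * k" and k: "0 < k"
  shows "\<exists>C. P = (\<Union>r<k. C r) \<and> disjoint_family_on C {..<k} \<and>
    (\<forall>r<k. card (C r) = s + 1 \<and> (\<forall>x\<in>C r. \<forall>y\<in>C r. x \<noteq> y \<longrightarrow> arc n k x \<inter> arc n k y = {}))"
proof -
  define N where "N = (s + 1) * k"
  define e where "e = (\<lambda>i. sorted_list_of_set P ! i)"
  have finP: "finite P" using P(1) finite_subset by blast
  have len: "length (sorted_list_of_set P) = N"
    using P(2) by (simp add: N_def)
  have bij: "bij_betw e {..<N} P"
    unfolding e_def using finP len by (intro bij_betw_nth) auto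
  have mono: "e a < e b" if "a < b" "b < N" for a b
    using that len strict_sorted_list_of_set[of P]
    by (auto simp: e_def intro: sorted_wrt_nth_less)
  have e_less: "e i < n" if "i < N" for i
    using bij P(1) that by (auto simp: bij_betw_def)
  define C where "C = (\<lambda>r. (\<lambda>i. e (r + i * k)) ` {..s})"
  have idx: "r + i * k < N" if "r < k" "i \<le> s" for r i
  proof -
    have "i * k \<le> s * k" using that by simp
    then show ?thesis using that unfolding N_def by (simp add: add_less_le_mono)
  qed
  have eq_iff: "e (r + i * k) = e (r' + i' * k) \<longleftrightarrow> r = r' \<and> i = i'"
    if "r < k" "i \<le> s" "r' < k" "i' \<le> s" for r i r' i'
  proof -
    have "e (r + i * k) = e (r' + i' * k) \<longleftrightarrow> r + i * k = r' + i' * k"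
      using bij idx that by (auto simp: bij_betw_def inj_on_def)
    also have "\<dots> \<longleftrightarrow> r = r' \<and> i = i'"
    proof
      assume eq: "r + i * k = r' + i' * k"
      have "(r + i * k) mod k = (r' + i' * k) mod k" "(r + i * k) div k = (r' + i' * k) div k"
        using eq by simp_all
      then show "r = r' \<and> i = i'" using that k by simp
    qed auto
    finally show ?thesis .
  qed
  have gap: "arc n k (e (r + i * k)) \<inter> arc n k (e (r + i' * k)) = {}"
    if r: "r < k" and i: "i < i'" "i' \<le> s" for r i i'
  proof (rule arc_disjoint)
    obtain d where d: "i' = Suc i + d"
      using i(1) by (metis Suc_leI le_iff_add)
    let ?a = "r + i * k" and ?b = "r + i' * k"
    have ab: "?b = ?a + (k + d * k)" by (simp add: d algebra_simps)
    have bN: "?b < N" using idx[OF r i(2)] .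
    have "e ?a + (k + d * k) \<le> e ?b"
      unfolding ab by (rule strict_enumeration_gap[of N]) (use mono bN ab in auto)
    then show "e ?a + k \<le> e ?b" by simp
    \<comment> \<open>The gap through the origin: \<open>?a\<close> points of \<open>P\<close>
      precede \<open>e ?a\<close> and \<open>N - 1 - ?b\<close> follow \<open>e ?b\<close>, so
      \<open>e ?a\<close> is at least \<open>?a\<close> and \<open>e ?b\<close> is at most
      \<open>n - N + ?b\<close>.\<close>
    have "e 0 + ?a \<le> e ?a"
      using strict_enumeration_gap[of N e 0 ?a] mono bN ab by simp
    moreover have "e ?b + (N - 1 - ?b) \<le> e (N - 1)"
      using strict_enumeration_gap[of N e ?b "N - 1 - ?b"] mono bN by simp
    moreover have "e (N - 1) < n" using e_less bN by simp
    moreover have "?b + k \<le> N + ?a"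
    proof -
      have "i' * k \<le> s * k" using i(2) by simp
      then show ?thesis by (simp add: N_def trans_le_add1)
    qed
    ultimately show "e ?b + k \<le> e ?a + n" using bN by linarith
  qed
  have "P = (\<Union>r<k. C r)"
  proof
    show "P \<subseteq> (\<Union>r<k. C r)"
    proof
      fix x assume "x \<in> P"
      then obtain a where a: "a < N" "x = e a"
        using bij by (auto simp: bij_betw_def)
      have "a div k \<le> s"
        using a(1) k by (simp add: N_def less_mult_imp_div_less flip: less_Suc_eq_le)
      then have "x \<in> C (a mod k)"
        unfolding C_def using a(2) by (intro image_eqI[of _ _ "a div k"]) auto
      then show "x \<in> (\<Union>r<k. C r)" using k by auto
    qed
    show "(\<Union>r<k. C r) \<subseteq> P"
      using bij idx by (auto simp: C_def bij_betw_def)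
  qed
  moreover have "disjoint_family_on C {..<k}"
    unfolding disjoint_family_on_def C_def using eq_iff by fastforce
  moreover have "card (C r) = s + 1" if "r < k" for r
  proof -
    have "inj_on (\<lambda>i. e (r + i * k)) {..s}"
      using eq_iff that by (auto simp: inj_on_def)
    then show ?thesis by (simp add: C_def card_image)
  qed
  moreover have "arc n k x \<inter> arc n k y = {}" if "r < k" "x \<in> C r" "y \<in> C r" "x \<noteq> y" for r x y
  proof -
    obtain i i' where i: "i \<le> s" "i' \<le> s" "x = e (r + i * k)" "y = e (r + i' * k)"
      using \<open>x \<in> C r\<close> \<open>y \<in> C r\<close> by (auto simp: C_def)
    with that have "i < i' \<or> i' < i" by (metis nat_neq_iff)
    then show ?thesis using gap that(1) i by (metis inf_commute)
  qed
  ultimately show ?thesis by blast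
qed

section \<open>Averaging over permutations\<close>

text \<open>Transitivity of the symmetric group on \<open>k\<close>-subsets: a bijection from
  \<open>B\<close> to \<open>B'\<close> is glued to one between their complements in
  \<open>V\<close>, which have equal size.\<close>

lemma ex_permutes_image:
  assumes "finite V" "B \<in> nsets V k" "B' \<in> nsets V k"
  shows "\<exists>\<tau>. \<tau> permutes V \<and> \<tau> ` B = B'"
proof -
  have B: "B \<subseteq> V" "finite B" "card B = k" and B': "B' \<subseteq> V" "finite B'" "card B' = k"
    using assms by (auto simp: nsets_def)
  obtain f where f: "bij_betw f B B'"
    using finite_same_card_bij B B' by metis
  have "card (V - B) = card (V - B')"
    using B B' assms(1) by (simp add: card_Diff_subset)
  then obtain g where g: "bij_betw g (V - B) (V - B')"
    using finite_same_card_bij assms(1) by (metis finite_Diff)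
  define \<tau> where "\<tau> = (\<lambda>x. if x \<in> V then if x \<in> B then f x else g x else x)"
  have "bij_betw \<tau> B B'"
    using f B(1) by (subst bij_betw_cong[of _ _ f]) (auto simp: \<tau>_def)
  moreover have "bij_betw \<tau> (V - B) (V - B')"
    using g by (subst bij_betw_cong[of _ _ g]) (auto simp: \<tau>_def)
  ultimately have "bij_betw \<tau> (B \<union> (V - B)) (B' \<union> (V - B'))"
    by (rule bij_betw_combine) auto
  then have "bij_betw \<tau> V V"
    using B(1) B'(1) by (simp add: Un_absorb1)
  then have "\<tau> permutes V"
    by (rule bij_imp_permutes) (simp add: \<tau>_def)
  with \<open>bij_betw \<tau> B B'\<close> show ?thesis by (auto simp: bij_betw_def)
qed

text \<open>A random permutation sends \<open>X\<close> to a uniformly distributed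
  \<open>k\<close>-subset: composing with a permutation that maps \<open>B\<close> to
  \<open>B'\<close> injects the fibre over \<open>B\<close> into the fibre over \<open>B'\<close>,
  so all fibres have the same size.\<close>

lemma card_permutations_into:
  assumes V: "finite V" "card V = n" and X: "X \<in> nsets V k" and F: "F \<subseteq> nsets V k"
  shows "card {\<sigma>. \<sigma> permutes V \<and> \<sigma> ` X \<in> F} * (n choose k) = card F * fact n"
proof -
  define S where "S = (\<lambda>B. {\<sigma>. \<sigma> permutes V \<and> \<sigma> ` X = B})"
  have fin: "finite (S B)" for B
    using finite_permutations[OF V(1)] by (rule rev_finite_subset) (auto simp: S_def)
  have le: "card (S B) \<le> card (S B')" if BB: "B \<in> nsets V k" "B' \<in> nsets V k" for B B'
  proof -
    obtain \<tau> where \<tau>: "\<tau> permutes V" "\<tau> ` B = B'"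
      using ex_permutes_image[OF V(1) BB] by blast
    have "(\<lambda>\<sigma>. \<tau> \<circ> \<sigma>) ` S B \<subseteq> S B'"
      using \<tau> by (auto simp: S_def image_comp[symmetric] intro: permutes_compose)
    moreover have "inj_on (\<lambda>\<sigma>. \<tau> \<circ> \<sigma>) (S B)"
      using permutes_inj[OF \<tau>(1)] by (auto simp: inj_on_def fun_eq_iff)
    ultimately show ?thesis by (meson card_inj_on_le fin)
  qed
  have const: "card (S B) = card (S X)" if "B \<in> nsets V k" for B
    using le[OF that X] le[OF X that] by simp
  \<comment> \<open>Stated for arbitrary \<open>G\<close> in order to be used twice: with all
    \<open>k\<close>-subsets, where the count \<open>fact n\<close> determines the fibre size, and
    then with \<open>F\<close>.\<close>
  have count: "card {\<sigma>. \<sigma> permutes V \<and> \<sigma> ` X \<in> G} = card G * card (S X)"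
    if G: "G \<subseteq> nsets V k" for G
  proof -
    have "finite G"
      using G V(1) by (meson finite_imp_finite_nsets finite_subset)
    have "{\<sigma>. \<sigma> permutes V \<and> \<sigma> ` X \<in> G} = (\<Union>B\<in>G. S B)"
      by (auto simp: S_def)
    also have "card \<dots> = (\<Sum>B\<in>G. card (S B))"
      using fin \<open>finite G\<close> by (intro card_UN_disjoint) (auto simp: S_def)
    also have "\<dots> = card G * card (S X)"
      using const G by (simp add: subset_iff)
    finally show ?thesis .
  qed
  have "\<sigma> ` X \<in> nsets V k" if "\<sigma> permutes V" for \<sigma>
    using X permutes_image[OF that] permutes_inj[OF that] that
    by (auto simp: nsets_def card_image inj_on_subset permutes_in_image)
  then have "{\<sigma>. \<sigma> permutes V \<and> \<sigma> ` X \<in> nsets V k} = {\<sigma>. \<sigma> permutes V}"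
    by auto
  then have "fact n = (n choose k) * card (S X)"
    using count[OF subset_refl] card_permutations[OF V(2,1)] V(2) by simp
  then show ?thesis
    using count[OF F] by simp
qed

text \<open>Double counting of the pairs of a permutation and a starting point whose arc is sent
  into \<open>F\<close>: for each of the \<open>n\<close> starting points
  \<open>card_permutations_into\<close> counts the permutations.\<close>

lemma sum_arcs_permutations:
  assumes k: "0 < k" "k \<le> n" and F: "F \<subseteq> nsets {1..n} k"
  shows "(\<Sum>\<sigma> | \<sigma> permutes {1..n}. card {x. x < n \<and> \<sigma> ` arc n k x \<in> F}) * (n choose k)
    = n * card F * fact n"
proof -
  let ?S = "{\<sigma>. \<sigma> permutes {1..n}}"
  have fin: "finite ?S" by (simp add: finite_permutations)
  have "(\<Sum>\<sigma>\<in>?S. card {x. x < n \<and> \<sigma> ` arc n k x \<in> F})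
      = (\<Sum>\<sigma>\<in>?S. \<Sum>x<n. if \<sigma> ` arc n k x \<in> F then 1 else 0)"
    by (intro sum.cong refl) (simp add: sum.If_cases Int_def)
  also have "\<dots> = (\<Sum>x<n. \<Sum>\<sigma>\<in>?S. if \<sigma> ` arc n k x \<in> F then 1 else 0)"
    by (rule sum.swap)
  also have "\<dots> = (\<Sum>x<n. card {\<sigma>. \<sigma> permutes {1..n} \<and> \<sigma> ` arc n k x \<in> F})"
    by (intro sum.cong refl) (simp add: sum.If_cases[OF fin] Int_def del: One_nat_def)
  finally show ?thesis
    using card_permutations_into[OF _ _ arc_in_nsets[OF k] F, of n]
    by (simp add: sum_distrib_right del: One_nat_def)
qed

section \<open>From the circle to the families\<close>

lemma admissible_bound:
  assumes adm: "admissible n k s \<B>" and k: "0 < k" and n: "(s + 1) * k \<le> n"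
  shows "p * card (\<B> 0) + (\<Sum>i = 1..s. card (\<B> i))
    \<le> max (s * (n choose k)) ((p + s) * s * ((n - 1) choose (k - 1)))"
proof -
  have mono: "\<B> i \<subseteq> \<B> j" if "i \<le> j" "j \<le> s" for i j
    using adm that by (auto simp: admissible_def mono_on_def)
  have sub: "\<B> i \<subseteq> nsets {1..n} k" if "i \<le> s" for i
    using adm that by (auto simp: admissible_def)
  have no_rainbow: "\<not> (\<exists>B. (\<forall>i\<in>{0..s}. B i \<in> \<B> i) \<and> disjoint_family_on B {0..s})"
    using adm by (simp add: admissible_def overlapping_iff)
  have kn: "k \<le> n" using n by simp
  define M where "M = max (s * k * n) ((p + s) * s * k * k)"
  define A where "A = (\<lambda>\<sigma> i. {x. x < n \<and> \<sigma> ` arc n k x \<in> \<B> i})"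
  let ?S = "{\<sigma>. \<sigma> permutes {1..n}}"
  have bound: "k * (p * card (A \<sigma> 0) + (\<Sum>i = 1..s. card (A \<sigma> i))) \<le> M"
    if \<sigma>: "\<sigma> permutes {1..n}" for \<sigma>
  proof -
    \<comment> \<open>If no index were deficient, \<open>rainbow_selection\<close> would pick
      distinct starting points in \<open>C\<close>, one for each family. Their arcs are disjoint,
      and so are the images under the injective \<open>\<sigma>\<close>: a forbidden rainbow
      matching.\<close>
    have defic: "\<exists>i\<le>s. card (A \<sigma> i \<inter> C) \<le> i"
      if C: "\<forall>x\<in>C. \<forall>y\<in>C. x \<noteq> y \<longrightarrow> arc n k x \<inter> arc n k y = {}" for C
    proof (rule ccontr)
      assume "\<not> (\<exists>i\<le>s. card (A \<sigma> i \<inter> C) \<le> i)"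
      then have "\<And>i. i \<le> s \<Longrightarrow> i < card (A \<sigma> i \<inter> C)"
        by (meson not_le)
      then obtain f where f: "inj_on f {0..s}" "\<forall>i\<in>{0..s}. f i \<in> A \<sigma> i \<inter> C"
        using rainbow_selection[of s "\<lambda>i. A \<sigma> i \<inter> C"] by blast
      have "disjoint_family_on (\<lambda>i. \<sigma> ` arc n k (f i)) {0..s}"
        unfolding disjoint_family_on_def
      proof (intro ballI impI)
        fix i j assume ij: "i \<in> {0..s}" "j \<in> {0..s}" "i \<noteq> j"
        then have "arc n k (f i) \<inter> arc n k (f j) = {}"
          using C f by (metis Int_iff inj_onD)
        then show "\<sigma> ` arc n k (f i) \<inter> \<sigma> ` arc n k (f j) = {}"
          using permutes_inj[OF \<sigma>] by (metis image_Int image_empty)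
      qed
      then show False using no_rainbow f(2) by (auto simp: A_def)
    qed
    interpret deficient_families "{..<n}" "A \<sigma>" n k s
    proof
      show "A \<sigma> i \<subseteq> A \<sigma> j" if "i \<le> j" "j \<le> s" for i j
        using mono[OF that] by (auto simp: A_def)
      show "\<exists>C. P = (\<Union>r<k. C r) \<and> disjoint_family_on C {..<k} \<and>
          (\<forall>r<k. card (C r) = s + 1 \<and> (\<exists>i\<le>s. card (A \<sigma> i \<inter> C r) \<le> i))"
        if P: "P \<subseteq> {..<n}" "card P = (s + 1) * k" for P
      proof -
        obtain C where "P = (\<Union>r<k. C r)" "disjoint_family_on C {..<k}"
          "\<forall>r<k. card (C r) = s + 1 \<and> (\<forall>x\<in>C r. \<forall>y\<in>C r. x \<noteq> y \<longrightarrow> arc n k x \<inter> arc n k y = {})"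
          using arc_classes[OF P k] by blast
        then show ?thesis using defic by (intro exI[of _ C]) simp
      qed
    qed (use k n in \<open>auto simp: A_def\<close>)
    show ?thesis using two_term_bound[of p] by (simp add: M_def)
  qed
  have avg: "(\<Sum>\<sigma>\<in>?S. card (A \<sigma> i)) * (n choose k) = n * card (\<B> i) * fact n" if "i \<le> s" for i
    using sum_arcs_permutations[OF k kn sub[OF that]] by (simp add: A_def)
  \<comment> \<open>The average is taken without division: the factor \<open>fact n\<close> comes
    from the number of permutations, and \<open>n\<close> and \<open>k\<close> from
    \<open>avg\<close> and \<open>bound\<close>.\<close>
  have "k * n * (p * card (\<B> 0) + (\<Sum>i = 1..s. card (\<B> i))) * fact n
      = k * (p * (n * card (\<B> 0) * fact n) + (\<Sum>i = 1..s. n * card (\<B> i) * fact n))"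
    by (simp add: algebra_simps sum_distrib_left)
  also have "\<dots> = k * (p * ((\<Sum>\<sigma>\<in>?S. card (A \<sigma> 0)) * (n choose k))
      + (\<Sum>i = 1..s. (\<Sum>\<sigma>\<in>?S. card (A \<sigma> i)) * (n choose k)))"
    by (simp add: avg del: One_nat_def)
  also have "\<dots> = k * (p * (\<Sum>\<sigma>\<in>?S. card (A \<sigma> 0))
      + (\<Sum>i = 1..s. \<Sum>\<sigma>\<in>?S. card (A \<sigma> i))) * (n choose k)"
    by (simp add: algebra_simps sum_distrib_left)
  also have "(\<Sum>i = 1..s. \<Sum>\<sigma>\<in>?S. card (A \<sigma> i)) = (\<Sum>\<sigma>\<in>?S. \<Sum>i = 1..s. card (A \<sigma> i))"
    by (rule sum.swap)
  also have "k * (p * (\<Sum>\<sigma>\<in>?S. card (A \<sigma> 0)) + \<dots>)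
      = (\<Sum>\<sigma>\<in>?S. k * (p * card (A \<sigma> 0) + (\<Sum>i = 1..s. card (A \<sigma> i))))"
    by (simp add: sum.distrib sum_distrib_left distrib_left)
  also have "\<dots> * (n choose k) \<le> (\<Sum>\<sigma>\<in>?S. M) * (n choose k)"
    using bound by (intro mult_right_mono sum_mono) auto
  also have "\<dots> = M * (n choose k) * fact n"
    using card_permutations[of "{1..n}" n] by simp
  finally have "k * n * (p * card (\<B> 0) + (\<Sum>i = 1..s. card (\<B> i))) \<le> M * (n choose k)"
    by simp
  also have "\<dots> = max (s * k * n * (n choose k)) ((p + s) * s * k * (k * (n choose k)))"
    by (simp add: M_def nat_mult_max_left mult.assoc)
  \<comment> \<open>The identity \<open>k * (n choose k) = n * ((n - 1) choose (k - 1))\<close>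
    exposes the common factor \<open>k * n\<close> in the second argument of the maximum.\<close>
  also have "\<dots> = k * n * max (s * (n choose k)) ((p + s) * s * ((n - 1) choose (k - 1)))"
    using times_binomial_minus1_eq[OF k, of n]
    by (simp add: nat_mult_max_right mult_ac)
  finally show ?thesis using k kn by simp
qed

theorem theorem1p3:
  fixes n k s p :: nat
  assumes "n > 0" and "k > 0" and "s > 0" and "p > 0"
    and "n \<ge> (s + 1) * k"
  shows "f_max (\<lambda>i. if i = 0 then real p else 1) n k s
    \<le> max (real (s * (n choose k))) (real ((p + s) * s * ((n - 1) choose (k - 1))))"
proof -
  let ?w = "\<lambda>i::nat. if i = 0 then real p else 1"
  have "(\<Sum>i = 0..s. ?w i * real (card (\<B> i)))
      \<le> max (real (s * (n choose k))) (real ((p + s) * s * ((n - 1) choose (k - 1))))"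
    if adm: "admissible n k s \<B>" for \<B>
  proof -
    have "(\<Sum>i = 0..s. ?w i * real (card (\<B> i)))
        = real (p * card (\<B> 0) + (\<Sum>i = 1..s. card (\<B> i)))"
      by (simp add: sum.atLeast_Suc_atMost)
    also have "\<dots> \<le> real (max (s * (n choose k)) ((p + s) * s * ((n - 1) choose (k - 1))))"
      using admissible_bound[OF adm assms(2,5)] by (rule of_nat_mono)
    finally show ?thesis by (simp add: of_nat_max)
  qed
  then show ?thesis
    unfolding f_max_def using f_max_set[of ?w s n k] by (subst Max_le_iff) auto
qed

end
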